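(* Let $A\in\mathbb{R}^{n\times n}$, $B\in\mathbb{R}^{n\times m}$, $C\in\mathbb{R}^{m\times n}$, $D\in\mathbb{R}^{m\times m}$, where $A$ is Hurwitz stable and $\|D\|<1$. Suppose there exist $H\in\mathbb{S}_+^{n+m}$, $f,g\in\mathbb{R}_+^m$ and $X\in\mathbb{Z}_0^m$, not all zero, such that, partitioning $H=\begin{bmatrix} H_{11} & H_{12} \\ H_{12}^T & H_{22} \end{bmatrix}$ with $H_{11}\in\mathbb{S}_+^n$, $H_{22}\in\mathbb{S}_+^m$, $$\mathrm{He}\{AH_{11}+BH_{12}^T\}=0,\qquad \begin{bmatrix} 0_{m,n} & I_m \end{bmatrix} H \begin{bmatrix} C^T \\ D^T-I_m \end{bmatrix}=\mathbf{1}_m f^T+g\mathbf{1}_m^T+X,$$ and suppose that $\mathrm{rank}(H)=1$, with $$H=\begin{bmatrix} h_1 \\ h_2 \end{bmatrix}\begin{bmatrix} h_1 \\ h_2 \end{bmatrix}^T,\quad h_1\in\mathbb{R}^n,\ h_2\in\mathbb{R}^m.$$ Then the following assertions hold: (i) $h_1\neq 0$. (ii) Define $z^\ast:=Ch_1+Dh_2$ and $w^\ast:=h_2$. Then there exists $\phi_{\mathrm{wc}}\in\mathrm{slope}[0,1]$ such that $\phi_{\mathrm{wc}}(z_i^\ast)=w_i^\ast$ for $i=1,\ldots,m$. (iii) Let $\phi_{\mathrm{wc}}$ be as in (ii) and define $\Phi_{\mathrm{wc}}:=\mathrm{diag}_m(\phi_{\mathrm{wc}})$. Then the feedback system $\Sigma$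 with the nonlinearity $\Phi=\Phi_{\mathrm{wc}}\in\mathbf{\Phi}_{0,1}^m$ is not stable. In particular, the state $x$ of $\Sigma$ corresponding to the initial state $x(0)=h_1$ is given by $x(t)=h_1$ for all $t\ge 0$.
   Context: Notation: $\mathbb{S}_+^k$ is the set of $k\times k$ real symmetric positive semidefinite matrices; $\mathbb{R}_+^m$ is the set of entrywise nonnegative vectors; $I_m$ is the identity matrix, $0_{m,n}$ the $m\times n$ zero matrix, $\mathbf{1}_m\in\mathbb{R}^m$ the all-ones vector. For a square matrix $S$, $\mathrm{He}\{S\}:=S+S^T$. $\|D\|$ is the norm induced by the Euclidean norm. A matrix is Hurwitz stable if all its eigenvalues have negative real part. $\mathbb{Z}_0^m$ is the set of matrices $X\in\mathbb{R}^{m\times m}$ with $X_{i,i}=0$ for all $i$ and $X_{i,j}\le 0$ for all $i\ne j$. For $\mu\le 0\le\nu$, $\phi\in\mathrm{slope}[\mu,\nu]$ means that $\phi:\mathbb{R}\to\mathbb{R}$ satisfies $\phi(0)=0$ and $\mu\le\frac{\phi(p)-\phi(q)}{p-q}\le\nu$ for all $p,q\in\mathbb{R}$, $p\neq q$. For $\phi:\mathbb{R}\to\mathbb{R}$, $\mathrm{diag}_m(\phi):\mathbb{R}^m\to\mathbb{R}^m$ applies $\phi$ to each of the $m$ components. $\mathbf{\Phi}_{\mu,\nu}^m:=\{\mathrm{diag}_m(\phi):\phi\in\mathrm{slope}[\mu,\nu]\}$. For a static nonlinearity $\Phi:\mathbb{R}^m\to\mathbb{R}^m$, the feedback system $\Sigma$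 is $$\dot x(t)=Ax(t)+Bw(t),\quad z(t)=Cx(t)+Dw(t),\quad w(t)=\Phi(z(t)),$$ with state $x(t)\in\mathbb{R}^n$. When $\|D\|<1$ and $\Phi\in\mathbf{\Phi}_{0,1}^m$, this system is well-posed. The system $\Sigma$ is said to be stable if the origin $x=0$ is globally asymptotically stable. *)

theory Defs
  imports "HOL-Analysis.Analysis"
begin

definition psd_matrices :: "(real^'k^'k) set" where
  "psd_matrices = {S. transpose S = S \<and> (\<forall>v. 0 \<le> v \<bullet> (S *v v))}"

definition He :: "real^'k^'k \<Rightarrow> real^'k^'k" where
  "He S = S + transpose S"

definition is_eigenvalue :: "complex^'n^'n \<Rightarrow> complex \<Rightarrow> bool" where
  "is_eigenvalue M c \<longleftrightarrow> (\<exists>v. v \<noteq> 0 \<and> M *v v = c *s v)"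

definition hurwitz_stable :: "real^'n^'n \<Rightarrow> bool" where
  "hurwitz_stable A \<longleftrightarrow> (\<forall>c. is_eigenvalue (map_matrix complex_of_real A) c \<longrightarrow> Re c < 0)"

text \<open>
  Block notation: the index set of an \<open>n + m\<close> dimensional space is the disjoint sum
  of the index sets of the two blocks. The same stacking operation serves for vectors
  (stacking entries) and for matrices (stacking rows).
\<close>

definition vstack :: "'a^'n \<Rightarrow> 'a^'m \<Rightarrow> 'a^('n + 'm)" where
  "vstack u v = (\<chi> k. case k of Inl i \<Rightarrow> u $ i | Inr j \<Rightarrow> v $ j)"

definition hstack :: "'a^'n^'k \<Rightarrow> 'a^'m^'k \<Rightarrow> 'a^('n + 'm)^'k" where
  "hstack M N = (\<chi> r. vstack (M $ r) (N $ r))"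

text \<open>
  The all-ones vector is the library's \<open>1\<close> of type \<open>real^'m\<close> (which is componentwise);
  the identity matrix is \<open>mat 1\<close>, not \<open>1\<close>.
\<close>

definition outer :: "real^'n \<Rightarrow> real^'m \<Rightarrow> real^'m^'n" where
  "outer u v = (\<chi> i j. u $ i * v $ j)"

definition Z0_matrices :: "(real^'m^'m) set" where
  "Z0_matrices = {X. (\<forall>i. X $ i $ i = 0) \<and> (\<forall>i j. i \<noteq> j \<longrightarrow> X $ i $ j \<le> 0)}"

definition slope :: "real \<Rightarrow> real \<Rightarrow> (real \<Rightarrow> real) set" where
  "slope \<mu> \<nu> = {\<phi>. \<phi> 0 = 0 \<and>
     (\<forall>p q. p \<noteq> q \<longrightarrow> \<mu> \<le> (\<phi> p - \<phi> q) / (p - q) \<and> (\<phi> p - \<phi> q) / (p - q) \<le> \<nu>)}"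

definition diag_map :: "(real \<Rightarrow> real) \<Rightarrow> real^'m \<Rightarrow> real^'m" where
  "diag_map \<phi> z = (\<chi> i. \<phi> (z $ i))"

definition Phi_class :: "real \<Rightarrow> real \<Rightarrow> (real^'m \<Rightarrow> real^'m) set" where
  "Phi_class \<mu> \<nu> = diag_map ` slope \<mu> \<nu>"

text \<open>
  Trajectories on \<open>t \<ge> 0\<close> are classical solutions, with a one-sided derivative at
  \<open>t = 0\<close>. The values of the signals at negative times are irrelevant.
\<close>

definition trajectory ::
  "real^'n^'n \<Rightarrow> real^'m^'n \<Rightarrow> real^'n^'m \<Rightarrow> real^'m^'m \<Rightarrow> (real^'m \<Rightarrow> real^'m) \<Rightarrow>
   (real \<Rightarrow> real^'n) \<Rightarrow> (real \<Rightarrow> real^'m) \<Rightarrow> (real \<Rightarrow> real^'m) \<Rightarrow> bool" where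
  "trajectory A B C D \<Phi> x z w \<longleftrightarrow>
     (\<forall>t\<ge>0. (x has_vector_derivative (A *v x t + B *v w t)) (at t within {0..}) \<and>
            z t = C *v x t + D *v w t \<and>
            w t = \<Phi> (z t))"

text \<open>
  Global asymptotic stability of the origin. Quantifying over all trajectories is adequate
  because the system is well-posed in the intended setting (\<open>D\<close> a strict contraction,
  \<open>\<Phi>\<close> induced by a nonlinearity with slope in \<open>[0, 1]\<close>): each initial state then has
  exactly one trajectory on \<open>t \<ge> 0\<close>.
\<close>

definition stable_system ::
  "real^'n^'n \<Rightarrow> real^'m^'n \<Rightarrow> real^'n^'m \<Rightarrow> real^'m^'m \<Rightarrow> (real^'m \<Rightarrow> real^'m) \<Rightarrow> bool" where
  "stable_system A B C D \<Phi> \<longleftrightarrow>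
     (\<forall>\<epsilon>>0. \<exists>\<delta>>0. \<forall>x z w. trajectory A B C D \<Phi> x z w \<longrightarrow> norm (x 0) < \<delta> \<longrightarrow>
        (\<forall>t\<ge>0. norm (x t) < \<epsilon>)) \<and>
     (\<forall>x z w. trajectory A B C D \<Phi> x z w \<longrightarrow> (x \<longlongrightarrow> 0) at_top)"

end

theory Submission
  imports Defs
begin

text \<open>
  Write \<open>v = A h1 + B h2\<close>. The Lyapunov-type equation reads \<open>v h1\<^sup>T + h1 v\<^sup>T = 0\<close>, which
  forces \<open>v = 0\<close> once \<open>h1 \<noteq> 0\<close>, so \<open>h1\<close> is an equilibrium as soon as \<open>\<phi> (z\<^sub>i) = w\<^sub>i\<close>. The
  second equation reads \<open>w\<^sub>i (z\<^sub>j - w\<^sub>j) = f\<^sub>j + g\<^sub>i + X\<^sub>i\<^sub>j\<close>. Its diagonal gives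
  \<open>w\<^sub>i (z\<^sub>i - w\<^sub>i) \<ge> 0\<close>, and comparing diagonal and off-diagonal entries gives
  \<open>(w\<^sub>i - w\<^sub>j) ((z\<^sub>i - w\<^sub>i) - (z\<^sub>j - w\<^sub>j)) \<ge> 0\<close>: the points \<open>(z\<^sub>i, w\<^sub>i)\<close> and the origin are exactly
  interpolable by a function with slope in \<open>[0, 1]\<close>. If \<open>h1 = 0\<close>, the diagonal inequalities
  give \<open>w \<bullet> D w \<ge> w \<bullet> w\<close>, whence \<open>w = 0\<close> and \<open>H = 0\<close>. Uniqueness of the trajectory is a
  Gronwall argument.
\<close>

section \<open>Block and rank-one matrices\<close>

lemma sum_UNIV_sum_type:
  fixes F :: "'n::finite + 'm::finite \<Rightarrow> 'a::comm_monoid_add"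
  shows "(\<Sum>k\<in>UNIV. F k) = (\<Sum>i\<in>UNIV. F (Inl i)) + (\<Sum>j\<in>UNIV. F (Inr j))"
  using sum.Plus[of "UNIV :: 'n set" "UNIV :: 'm set" F] by (simp add: comp_def)

lemma vstack_nth [simp]:
  "vstack u v $ Inl i = u $ i" "vstack u v $ Inr j = v $ j"
  by (simp_all add: vstack_def)

lemma hstack_mult_vstack:
  fixes M :: "real^'n^'k" and N :: "real^'m^'k"
  shows "hstack M N *v vstack u v = M *v u + N *v v"
  by (simp add: vec_eq_iff matrix_vector_mult_def hstack_def sum_UNIV_sum_type)

lemma vstack_mult_vstack:
  fixes M :: "real^'k^'n" and N :: "real^'k^'m"
  shows "vstack u v v* vstack M N = u v* M + v v* N"
  by (simp add: vec_eq_iff vector_matrix_mult_def sum_UNIV_sum_type)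

lemma mult_outer_mult: "M ** outer u v ** N = outer (M *v u) (v v* N)"
  by (simp add: vec_eq_iff matrix_matrix_mult_def outer_def matrix_vector_mult_def
      vector_matrix_mult_def sum_distrib_left sum_distrib_right mult_ac)
    (intro allI, rule sum.swap)

lemma mult_outer: "M ** outer u v = outer (M *v u) v"
  using mult_outer_mult[of M u v "mat 1"] by simp

lemma outer_add_left: "outer (u + u') v = outer u v + outer u' v"
  by (simp add: vec_eq_iff outer_def algebra_simps)

lemma outer_zero_left [simp]: "outer 0 v = 0"
  by (simp add: vec_eq_iff outer_def)

lemma transpose_outer: "transpose (outer u v) = outer v u"
  by (simp add: vec_eq_iff outer_def transpose_def)

lemma outer_mult_vec: "outer u v *v x = (v \<bullet> x) *\<^sub>R u"
  by (simp add: vec_eq_iff outer_def matrix_vector_mult_def inner_vec_def sum_distrib_left mult_ac)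

text \<open>Applying the symmetric matrix to \<open>h\<close> gives
  \<open>(h \<bullet> h) v + (v \<bullet> h) h = 0\<close>. Pairing with \<open>h\<close> doubles
  the same term, so \<open>v\<close> is orthogonal to \<open>h\<close>, and then the first summand
  alone vanishes.\<close>

lemma He_outer_eq_0:
  assumes "He (outer v h) = 0" "h \<noteq> 0"
  shows "v = 0"
proof -
  have "(outer v h + outer h v) *v h = 0"
    using assms(1) by (simp add: He_def transpose_outer)
  then have eq: "(h \<bullet> h) *\<^sub>R v + (v \<bullet> h) *\<^sub>R h = 0"
    by (simp add: matrix_vector_mult_add_rdistrib outer_mult_vec)
  then have "((h \<bullet> h) *\<^sub>R v + (v \<bullet> h) *\<^sub>R h) \<bullet> h = 0"
    by simp
  then have "v \<bullet> h = 0"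
    using assms(2) by (simp add: inner_add_left)
  with eq assms(2) show ?thesis
    by simp
qed

section \<open>Interpolation by slope-restricted functions\<close>

text \<open>Clearing the denominator for ordered pairs: both \<phi> and \<open>p - \<phi> p\<close>
  are nondecreasing. This division-free form passes easily to maxima.\<close>

lemma slope_0_1_iff:
  "\<phi> \<in> slope 0 1 \<longleftrightarrow> \<phi> 0 = 0 \<and> (\<forall>p q. p \<le> q \<longrightarrow> \<phi> p \<le> \<phi> q \<and> \<phi> q \<le> \<phi> p + (q - p))"
  (is "_ \<longleftrightarrow> _ \<and> ?R")
proof -
  have "(\<forall>p q. p \<noteq> q \<longrightarrow> 0 \<le> (\<phi> p - \<phi> q) / (p - q) \<and> (\<phi> p - \<phi> q) / (p - q) \<le> 1) \<longleftrightarrow> ?R"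
    (is "?L \<longleftrightarrow> _")
  proof
    assume L: ?L
    show ?R
    proof (intro allI impI)
      fix p q :: real
      assume "p \<le> q"
      then show "\<phi> p \<le> \<phi> q \<and> \<phi> q \<le> \<phi> p + (q - p)"
        using L[rule_format, of q p]
        by (cases "p = q") (auto simp: divide_simps)
    qed
  next
    assume R: ?R
    show ?L
    proof (intro allI impI)
      fix p q :: real
      assume "p \<noteq> q"
      then show "0 \<le> (\<phi> p - \<phi> q) / (p - q) \<and> (\<phi> p - \<phi> q) / (p - q) \<le> 1"
        using R[rule_format, of p q] R[rule_format, of q p]
        by (cases "p < q") (auto simp: divide_simps)
    qed
  qed
  then show ?thesis
    by (simp add: slope_def)
qed

text \<open>
  The interpolant is the upper envelope of the ramps \<open>x \<mapsto> u + min 0 (x - p)\<close>, the least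
  slope-restricted functions through the individual points \<open>(p, u)\<close>.
\<close>

lemma slope_0_1_interpolation:
  fixes P :: "(real \<times> real) set"
  assumes "finite P" "(0, 0) \<in> P"
    and inc: "\<And>p u q v. (p, u) \<in> P \<Longrightarrow> (q, v) \<in> P \<Longrightarrow> 0 \<le> (u - v) * ((p - u) - (q - v))"
  obtains \<phi> where "\<phi> \<in> slope 0 1" "\<And>p u. (p, u) \<in> P \<Longrightarrow> \<phi> p = u"
proof -
  define r where "r x = (\<lambda>(p, u). u + min 0 (x - p))" for x :: real and pu :: "real \<times> real"
  define \<phi> where "\<phi> x = Max (r x ` P)" for x
  have ge: "r x pu \<le> \<phi> x" if "pu \<in> P" for x pu
    unfolding \<phi>_def using assms(1) that by simp
  have att: "\<exists>pu\<in>P. \<phi> x = r x pu" for x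
  proof -
    have "\<phi> x \<in> r x ` P"
      unfolding \<phi>_def using assms(1,2) by (intro Max_in) auto
    then show ?thesis by auto
  qed
  have interp: "\<phi> p = u" if pu: "(p, u) \<in> P" for p u
  proof (rule antisym)
    obtain q v where qv: "(q, v) \<in> P" "\<phi> p = r p (q, v)"
      using att[of p] by auto
    have nn: "0 \<le> (u - v) * ((p - u) - (q - v))"
      using inc[OF pu qv(1)] .
    \<comment> \<open>A ramp from \<open>(q, v)\<close> passing above \<open>(p, u)\<close> would
      give both \<open>u < v\<close> and \<open>p - u > q - v\<close>, making the product in
      \<open>inc\<close> negative.\<close>
    have "v + min 0 (p - q) \<le> u"
    proof (rule ccontr)
      assume "\<not> ?thesis"
      then have "u - v < 0" "(p - u) - (q - v) > 0"
        by (auto simp: min_def split: if_splits)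
      then have "(u - v) * ((p - u) - (q - v)) < 0"
        by (rule mult_neg_pos)
      with nn show False by simp
    qed
    then show "\<phi> p \<le> u"
      using qv(2) by (simp add: r_def)
    show "u \<le> \<phi> p"
      using ge[OF pu, of p] by (simp add: r_def)
  qed
  \<comment> \<open>Every ramp satisfies both bounds. They pass to the maximum by following the ramp
    active at \<open>p\<close> for monotonicity and the one active at \<open>q\<close> for the
    growth bound.\<close>
  have "\<phi> p \<le> \<phi> q \<and> \<phi> q \<le> \<phi> p + (q - p)" if "p \<le> q" for p q
  proof
    obtain a where a: "a \<in> P" "\<phi> p = r p a" using att by blast
    have "r p a \<le> r q a"
      using that by (auto simp: r_def split: prod.split)
    with a ge[OF a(1), of q] show "\<phi> p \<le> \<phi> q" by simp
    obtain b where b: "b \<in> P" "\<phi> q = r q b" using att by blast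
    have "r q b \<le> r p b + (q - p)"
      using that by (auto simp: r_def split: prod.split)
    with b ge[OF b(1), of p] show "\<phi> q \<le> \<phi> p + (q - p)" by simp
  qed
  moreover have "\<phi> 0 = 0"
    using interp[OF assms(2)] .
  ultimately have "\<phi> \<in> slope 0 1"
    by (simp add: slope_0_1_iff)
  with interp show thesis
    using that by blast
qed

lemma slope_0_1_lipschitz:
  assumes "\<phi> \<in> slope 0 1"
  shows "\<bar>\<phi> p - \<phi> q\<bar> \<le> \<bar>p - q\<bar>"
proof (cases "p \<le> q")
  case True
  then have "\<phi> p \<le> \<phi> q \<and> \<phi> q \<le> \<phi> p + (q - p)"
    using assms unfolding slope_0_1_iff by blast
  with True show ?thesis by simp
next
  case False
  then have "\<phi> q \<le> \<phi> p \<and> \<phi> p \<le> \<phi> q + (p - q)"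
    using assms unfolding slope_0_1_iff by simp
  with False show ?thesis by simp
qed

lemma norm_diag_map_diff_le:
  assumes "\<phi> \<in> slope 0 1"
  shows "norm (diag_map \<phi> y - diag_map \<phi> z) \<le> norm (y - z)"
  by (rule norm_le_componentwise_cart) (simp add: diag_map_def slope_0_1_lipschitz[OF assms])

section \<open>Uniqueness of trajectories\<close>

text \<open>The squared norm of \<open>d\<close>, weighted by \<open>exp (- 2 * L * s)\<close>, is
  nonincreasing and starts at 0. Squaring keeps it differentiable at zeros of
  \<open>d\<close>.\<close>

lemma gronwall_zero:
  fixes d :: "real \<Rightarrow> 'a::real_inner"
  assumes der: "\<And>t. 0 \<le> t \<Longrightarrow> (d has_vector_derivative d' t) (at t within {0..})"
    and bound: "\<And>t. 0 \<le> t \<Longrightarrow> norm (d' t) \<le> L * norm (d t)"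
    and "d 0 = 0" "0 \<le> t"
  shows "d t = 0"
proof (cases "t = 0")
  case False
  with assms(4) have t: "0 < t" by simp
  define u where "u s = exp (- 2 * L * s) * (d s \<bullet> d s)" for s
  define u' where "u' s = exp (- 2 * L * s) * (2 * (d s \<bullet> d' s) - 2 * L * (d s \<bullet> d s))" for s
  \<comment> \<open>The mean value theorem is applied on \<open>{0..t}\<close>, so derivatives are
    restricted to that interval.\<close>
  have du: "(u has_real_derivative u' s) (at s within {0..t})" if "0 \<le> s" for s
  proof -
    have "(d has_derivative (\<lambda>h. h *\<^sub>R d' s)) (at s within {0..t})"
      using has_vector_derivative_within_subset[OF der[OF that], of "{0..t}"]
      by (simp add: has_vector_derivative_def)
    from has_derivative_inner[OF this this]
    have "((\<lambda>s. d s \<bullet> d s) has_real_derivative 2 * (d s \<bullet> d' s)) (at s within {0..t})"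
      by (simp add: has_field_derivative_def inner_commute algebra_simps mult_commute_abs)
    then show ?thesis
      unfolding u_def[abs_def] u'_def
      by (auto intro!: derivative_eq_intros simp: algebra_simps)
  qed
  have neg: "u' s \<le> 0" if "0 \<le> s" for s
  proof -
    have "d s \<bullet> d' s \<le> norm (d s) * norm (d' s)"
      by (rule norm_cauchy_schwarz)
    also have "\<dots> \<le> norm (d s) * (L * norm (d s))"
      using bound[OF that] by (rule mult_left_mono) simp
    also have "\<dots> = L * (d s \<bullet> d s)"
      by (simp add: dot_square_norm power2_eq_square)
    finally show ?thesis
      by (simp add: u'_def mult_nonneg_nonpos)
  qed
  obtain s where s: "s \<in> {0<..<t}" "u t - u 0 = u' s * (t - 0)"
    using mvt_simple[OF t, of u "\<lambda>s h. u' s * h"] du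
    by (auto simp: has_field_derivative_def)
  have "u t - u 0 \<le> 0"
    using s neg[of s] t by (simp add: mult_nonpos_nonneg)
  then have "exp (- 2 * L * t) * (d t \<bullet> d t) \<le> 0"
    using assms(3) by (simp add: u_def)
  then have "d t \<bullet> d t \<le> 0"
    by (simp add: mult_le_0_iff)
  then show ?thesis
    by (metis inner_eq_zero_iff inner_ge_zero order_antisym)
qed (use assms(3) in simp)

text \<open>The algebraic loop is a contraction, so the difference of the inputs \<open>w\<close> is
  controlled by that of the states. The state difference then obeys a linear growth bound and
  Gronwall applies.\<close>

lemma trajectory_unique:
  fixes A :: "real^'n^'n" and B :: "real^'m^'n" and C :: "real^'n^'m" and D :: "real^'m^'m"
  assumes D: "onorm (\<lambda>v. D *v v) < 1"
    and lip: "\<And>y z. norm (\<Phi> y - \<Phi> z) \<le> norm (y - z)"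
    and tr: "trajectory A B C D \<Phi> x z w" "trajectory A B C D \<Phi> x' z' w'"
    and "x 0 = x' 0" "0 \<le> t"
  shows "x t = x' t"
proof -
  let ?D = "onorm (\<lambda>v. D *v v)"
  \<comment> \<open>\<open>?K\<close> results from solving
    \<open>\<Delta>w \<le> onorm C * \<Delta>x + onorm D * \<Delta>w\<close> for
    \<open>\<Delta>w\<close>, where \<open>\<Delta>\<close> denotes the norm of a difference;
    \<open>?L\<close> is the resulting Lipschitz constant of the closed loop.\<close>
  let ?K = "onorm (\<lambda>v. C *v v) / (1 - ?D)"
  let ?L = "onorm (\<lambda>v. A *v v) + onorm (\<lambda>v. B *v v) * ?K"
  have out: "z s = C *v x s + D *v w s" and fb: "w s = \<Phi> (z s)"
    if "trajectory A B C D \<Phi> x z w" "0 \<le> s" for x z w s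
    using that unfolding trajectory_def by blast+
  have w_le: "norm (w s - w' s) \<le> ?K * norm (x s - x' s)" if "0 \<le> s" for s
  proof -
    have "z s - z' s = C *v (x s - x' s) + D *v (w s - w' s)"
      using out[OF tr(1) that] out[OF tr(2) that] by (simp add: matrix_vector_mult_diff_distrib)
    moreover have "norm (w s - w' s) \<le> norm (z s - z' s)"
      using fb[OF tr(1) that] fb[OF tr(2) that] lip[of "z s" "z' s"] by simp
    ultimately have "norm (w s - w' s) \<le> norm (C *v (x s - x' s)) + norm (D *v (w s - w' s))"
      by (metis norm_triangle_ineq order_trans)
    also have "\<dots> \<le> onorm (\<lambda>v. C *v v) * norm (x s - x' s) + ?D * norm (w s - w' s)"
      by (intro add_mono onorm matrix_vector_mul_bounded_linear)
    finally show ?thesis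
      using D by (simp add: field_simps)
  qed
  have "x t - x' t = 0"
  proof (rule gronwall_zero[where d = "\<lambda>t. x t - x' t" and L = ?L
        and d' = "\<lambda>t. A *v (x t - x' t) + B *v (w t - w' t)"])
    fix s :: real
    assume s: "0 \<le> s"
    have "(x has_vector_derivative A *v x s + B *v w s) (at s within {0..})"
      "(x' has_vector_derivative A *v x' s + B *v w' s) (at s within {0..})"
      using tr s unfolding trajectory_def by blast+
    from has_vector_derivative_diff[OF this]
    show "((\<lambda>t. x t - x' t) has_vector_derivative A *v (x s - x' s) + B *v (w s - w' s))
        (at s within {0..})"
      by (simp add: matrix_vector_mult_diff_distrib algebra_simps)
    have "norm (A *v (x s - x' s) + B *v (w s - w' s))
        \<le> norm (A *v (x s - x' s)) + norm (B *v (w s - w' s))"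
      by (rule norm_triangle_ineq)
    also have "\<dots> \<le> onorm (\<lambda>v. A *v v) * norm (x s - x' s)
        + onorm (\<lambda>v. B *v v) * norm (w s - w' s)"
      by (intro add_mono onorm matrix_vector_mul_bounded_linear)
    also have "\<dots> \<le> onorm (\<lambda>v. A *v v) * norm (x s - x' s)
        + onorm (\<lambda>v. B *v v) * (?K * norm (x s - x' s))"
      by (intro add_left_mono mult_left_mono w_le s onorm_pos_le matrix_vector_mul_bounded_linear)
    finally show "norm (A *v (x s - x' s) + B *v (w s - w' s)) \<le> ?L * norm (x s - x' s)"
      by (simp add: algebra_simps)
  qed (use assms in auto)
  then show ?thesis by simp
qed

section \<open>From the rank-one certificate to a destabilizing nonlinearity\<close>

theorem theorem1:
  fixes A :: "real^'n^'n" and B :: "real^'m^'n" and C :: "real^'n^'m" and D :: "real^'m^'m"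
    and H :: "real^('n + 'm)^('n + 'm)"
    and H11 :: "real^'n^'n" and H12 :: "real^'m^'n" and H22 :: "real^'m^'m"
    and f g :: "real^'m" and X :: "real^'m^'m"
    and h1 :: "real^'n" and h2 :: "real^'m"
    and zs ws :: "real^'m"
  assumes "hurwitz_stable A"
    and "onorm (\<lambda>v. D *v v) < 1"
    and "H \<in> psd_matrices"
    and "\<forall>i. 0 \<le> f $ i" and "\<forall>i. 0 \<le> g $ i"
    and "X \<in> Z0_matrices"
    and "\<not> (H = 0 \<and> f = 0 \<and> g = 0 \<and> X = 0)"
    and "H = vstack (hstack H11 H12) (hstack (transpose H12) H22)"
    and "H11 \<in> psd_matrices" and "H22 \<in> psd_matrices"
    and "He (A ** H11 + B ** transpose H12) = 0"
    and "hstack (0 :: real^'n^'m) (mat 1 :: real^'m^'m) ** H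
           ** vstack (transpose C) (transpose D - mat 1)
         = outer 1 f + outer g 1 + X"
    and "rank H = 1"
    and "H = outer (vstack h1 h2) (vstack h1 h2)"
    and "zs = C *v h1 + D *v h2" and "ws = h2"
  shows "h1 \<noteq> 0
    \<and> (\<exists>\<phi> \<in> slope 0 1. \<forall>i. \<phi> (zs $ i) = ws $ i)
    \<and> (\<forall>\<phi> \<in> slope 0 1. (\<forall>i. \<phi> (zs $ i) = ws $ i) \<longrightarrow>
          (diag_map \<phi> :: real^'m \<Rightarrow> real^'m) \<in> Phi_class 0 1
        \<and> \<not> stable_system A B C D (diag_map \<phi>)
        \<and> (\<exists>z w. trajectory A B C D (diag_map \<phi>) (\<lambda>t. h1) z w)
        \<and> (\<forall>x z w. trajectory A B C D (diag_map \<phi>) x z w \<and> x 0 = h1 \<longrightarrow>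
              (\<forall>t\<ge>0. x t = h1)))"
proof -
  note D = assms(2) and H_eq = assms(14) and zs = assms(15) and ws = assms(16)
  have H11: "H11 = outer h1 h1"
    using assms(8) unfolding H_eq
    by (metis (no_types, lifting) outer_def hstack_def vstack_nth vec_lambda_beta vec_eq_iff)
  have H12: "transpose H12 = outer h2 h1"
  proof -
    have "transpose H12 $ i $ j = H $ Inr i $ Inl j" for i j
      by (simp add: assms(8) hstack_def)
    then show ?thesis
      by (simp add: H_eq outer_def vec_eq_iff)
  qed
  have He0: "He (outer (A *v h1 + B *v h2) h1) = 0"
    using assms(11) by (simp add: H11 H12 mult_outer outer_add_left)
  \<comment> \<open>The left factor selects \<open>h2\<close> from the stacked vector; the right
    factor turns the stacked row into \<open>zs - ws\<close>.\<close>
  have M_eq: "outer ws (zs - ws) = outer 1 f + outer g 1 + X"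
  proof -
    have "h1 v* transpose C + h2 v* (transpose D - mat 1) = zs - ws"
      by (simp add: zs ws vector_matrix_mult_diff_rdistrib)
    then show ?thesis
      using assms(12)
      by (simp add: H_eq mult_outer_mult hstack_mult_vstack vstack_mult_vstack ws)
  qed
  have M: "ws $ i * (zs $ j - ws $ j) = f $ j + g $ i + X $ i $ j" for i j
    using arg_cong[OF M_eq, of "\<lambda>M. M $ i $ j"] by (simp add: outer_def)
  have diag: "ws $ i * (zs $ i - ws $ i) = f $ i + g $ i" for i
    using M[of i i] assms(6) by (simp add: Z0_matrices_def)
  have offdiag: "ws $ i * (zs $ j - ws $ j) \<le> f $ j + g $ i" for i j
  proof -
    have "X $ i $ j \<le> 0"
      using assms(6) by (cases "i = j") (auto simp: Z0_matrices_def)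
    with M[of i j] show ?thesis by simp
  qed
  have pos: "0 \<le> ws $ i * (zs $ i - ws $ i)" for i
    using assms(4,5) by (simp add: diag)
  \<comment> \<open>Expanding the product, the two diagonal identities minus the two off-diagonal
    bounds cancel all entries of \<open>f\<close> and \<open>g\<close>.\<close>
  have inc: "0 \<le> (ws $ i - ws $ j) * ((zs $ i - ws $ i) - (zs $ j - ws $ j))" for i j
    using diag[of i] diag[of j] offdiag[of i j] offdiag[of j i] by (simp add: algebra_simps)

  have h1: "h1 \<noteq> 0"
  proof
    assume h1: "h1 = 0"
    \<comment> \<open>With \<open>h1 = 0\<close> one has \<open>zs = D *v h2\<close>, so
      nonnegativity of this sum is incompatible with the strict contraction unless
      \<open>h2 = 0\<close>; then \<open>H = 0\<close> contradicts rank one.\<close>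
    have "0 \<le> ws \<bullet> (zs - ws)"
      unfolding inner_vec_def using pos by (simp add: sum_nonneg)
    then have "norm h2 * norm h2 \<le> h2 \<bullet> (D *v h2)"
      by (simp add: zs ws h1 inner_diff_right dot_square_norm power2_eq_square)
    also have "\<dots> \<le> norm h2 * norm (D *v h2)"
      by (rule norm_cauchy_schwarz)
    also have "\<dots> \<le> norm h2 * (onorm (\<lambda>v. D *v v) * norm h2)"
      by (intro mult_left_mono onorm matrix_vector_mul_bounded_linear) simp
    finally have "(1 - onorm (\<lambda>v. D *v v)) * (norm h2 * norm h2) \<le> 0"
      by (simp add: algebra_simps)
    then have "h2 = 0"
      using D by (auto simp: mult_le_0_iff)
    with h1 have "vstack h1 h2 = 0"
      by (simp add: vstack_def vec_eq_iff split: sum.split)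
    then have "H = 0"
      by (simp add: H_eq)
    with assms(13) show False
      by simp
  qed

  have ex: "\<exists>\<phi>\<in>slope 0 1. \<forall>i. \<phi> (zs $ i) = ws $ i"
  proof -
    \<comment> \<open>The origin is added to force \<open>\<phi> 0 = 0\<close>. Its compatibility
      with a data point is \<open>pos\<close>; that of two data points is
      \<open>inc\<close>.\<close>
    let ?P = "insert (0, 0) (range (\<lambda>i. (zs $ i, ws $ i)))"
    obtain \<phi> where "\<phi> \<in> slope 0 1" "\<And>p u. (p, u) \<in> ?P \<Longrightarrow> \<phi> p = u"
    proof (rule slope_0_1_interpolation[of ?P])
      show "0 \<le> (u - v) * (p - u - (q - v))" if "(p, u) \<in> ?P" "(q, v) \<in> ?P" for p u q v
        using that pos inc by (auto simp: algebra_simps)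
    qed auto
    then show ?thesis by blast
  qed

  have equilibrium: "A *v h1 + B *v h2 = 0"
    using He_outer_eq_0[OF He0 h1] .
  have "(diag_map \<phi> :: real^'m \<Rightarrow> real^'m) \<in> Phi_class 0 1
      \<and> \<not> stable_system A B C D (diag_map \<phi>)
      \<and> (\<exists>z w. trajectory A B C D (diag_map \<phi>) (\<lambda>t. h1) z w)
      \<and> (\<forall>x z w. trajectory A B C D (diag_map \<phi>) x z w \<and> x 0 = h1 \<longrightarrow> (\<forall>t\<ge>0. x t = h1))"
    if \<phi>: "\<phi> \<in> slope 0 1" "\<forall>i. \<phi> (zs $ i) = ws $ i" for \<phi>
  proof -
    have "diag_map \<phi> zs = h2"
      using \<phi>(2) ws by (simp add: diag_map_def vec_eq_iff)
    then have const: "trajectory A B C D (diag_map \<phi>) (\<lambda>t. h1) (\<lambda>t. zs) (\<lambda>t. h2)"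
      by (simp add: trajectory_def equilibrium zs)
    \<comment> \<open>Attractivity is what fails: the constant trajectory at the nonzero equilibrium
      \<open>h1\<close> does not converge to the origin.\<close>
    have "\<not> ((\<lambda>t::real. h1) \<longlongrightarrow> 0) at_top"
      using h1 by (simp add: tendsto_const_iff)
    with const have "\<not> stable_system A B C D (diag_map \<phi>)"
      unfolding stable_system_def by blast
    moreover have "x t = h1"
      if "trajectory A B C D (diag_map \<phi>) x z w" "x 0 = h1" "0 \<le> t" for x z w t
      using trajectory_unique[OF D norm_diag_map_diff_le[OF \<phi>(1)] that(1) const] that(2,3)
      by simp
    ultimately show ?thesis
      using \<phi>(1) const unfolding Phi_class_def by blast
  qed
  with h1 ex show ?thesis
    by blast
qed

end
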